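(* Let $k$ be a field of characteristic zero and let $B$ be a subalgebra of the $k$-algebra $W(2)$ of codimension $1$. Then $B$ is the linear span of $\alpha_{11}^1,\ \alpha_{12}^1,\ \alpha_{21}^1,\ \alpha_{22}^1,\ \alpha_{12}^2,\ \alpha_{21}^2,\ \alpha_{22}^2$.
   Context: Let $E_2$ be a $2$-dimensional $k$-vector space with basis $v_1,v_2$. The algebra $W(2)$ is the $8$-dimensional vector space of all bilinear maps $E_2\times E_2\to E_2$, with the (nonassociative) multiplication $$(A\cdot B)(x,y)=A(v_1,B(x,y))-B(A(v_1,x),y)-B(x,A(v_1,y)),\qquad x,y\in E_2.$$ For $i,j,m\in\{1,2\}$, $\alpha_{ij}^m\in W(2)$ denotes the bilinear map with $\alpha_{ij}^m(v_t,v_l)=\delta_{it}\delta_{jl}v_m$; these eight elements form a basis of $W(2)$. A subalgebra is a linear subspace closed under the multiplication. *)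

theory Defs
  imports Complex_Main "HOL-Library.Function_Algebras"
begin

locale two_dim_space = vector_space scale
  for scale :: "'k::field \<Rightarrow> 'v::ab_group_add \<Rightarrow> 'v" +
  fixes v :: "nat \<Rightarrow> 'v"  \<comment> \<open>only \<open>v 1\<close> and \<open>v 2\<close> are used\<close>
  assumes inj_v: "inj_on v {1, 2}"
    and independent_v: "independent (v ` {1, 2})"
    and span_v: "span (v ` {1, 2}) = UNIV"

text \<open>Maps \<open>E \<times> E \<rightarrow> E\<close> are curried; their vector space structure is pointwise, with the additive
  part taken from \<^theory>\<open>HOL-Library.Function_Algebras\<close>.\<close>

definition map_scale :: "('k \<Rightarrow> 'v \<Rightarrow> 'v) \<Rightarrow> 'k \<Rightarrow> ('v \<Rightarrow> 'v \<Rightarrow> 'v) \<Rightarrow> 'v \<Rightarrow> 'v \<Rightarrow> 'v" where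
  "map_scale scale c A = (\<lambda>x y. scale c (A x y))"

definition W2 :: "('k::field \<Rightarrow> 'v::ab_group_add \<Rightarrow> 'v) \<Rightarrow> ('v \<Rightarrow> 'v \<Rightarrow> 'v) set" where
  "W2 scale = {A. (\<forall>x. Vector_Spaces.linear scale scale (\<lambda>y. A x y)) \<and>
                  (\<forall>y. Vector_Spaces.linear scale scale (\<lambda>x. A x y))}"

definition W2_mult ::
  "(nat \<Rightarrow> 'v::ab_group_add) \<Rightarrow> ('v \<Rightarrow> 'v \<Rightarrow> 'v) \<Rightarrow> ('v \<Rightarrow> 'v \<Rightarrow> 'v) \<Rightarrow> 'v \<Rightarrow> 'v \<Rightarrow> 'v" where
  "W2_mult v A B = (\<lambda>x y. A (v 1) (B x y) - B (A (v 1) x) y - B x (A (v 1) y))"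

definition W2_subalgebra ::
  "('k::field \<Rightarrow> 'v::ab_group_add \<Rightarrow> 'v) \<Rightarrow> (nat \<Rightarrow> 'v) \<Rightarrow> ('v \<Rightarrow> 'v \<Rightarrow> 'v) set \<Rightarrow> bool" where
  "W2_subalgebra scale v B \<longleftrightarrow>
     B \<subseteq> W2 scale \<and> module.subspace (map_scale scale) B \<and>
     (\<forall>A\<in>B. \<forall>C\<in>B. W2_mult v A C \<in> B)"

text \<open>\<open>alpha scale v i j m\<close> is $\alpha_{ij}^m$; existence and uniqueness of the described map for
  \<open>i, j, m \<in> {1, 2}\<close> are shown in \<open>alpha_unique\<close> below.\<close>

definition alpha ::
  "('k::field \<Rightarrow> 'v::ab_group_add \<Rightarrow> 'v) \<Rightarrow> (nat \<Rightarrow> 'v) \<Rightarrow> nat \<Rightarrow> nat \<Rightarrow> nat \<Rightarrow> 'v \<Rightarrow> 'v \<Rightarrow> 'v" where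
  "alpha scale v i j m =
     (THE A. A \<in> W2 scale \<and>
        (\<forall>t\<in>{1, 2}. \<forall>l\<in>{1, 2}. A (v t) (v l) = (if i = t \<and> j = l then v m else 0)))"

context two_dim_space
begin

sublocale maps: vector_space "map_scale scale"
  by unfold_locales
    (auto simp: map_scale_def fun_eq_iff scale_right_distrib scale_left_distrib)

lemma linear_iff:
  "Vector_Spaces.linear scale scale f \<longleftrightarrow>
     (\<forall>x y. f (x + y) = f x + f y) \<and> (\<forall>c x. f (scale c x) = scale c (f x))"
  by (auto simp: Vector_Spaces.linear_def module_hom_def module_hom_axioms_def
      vector_space_axioms module_axioms)

lemma W2_eqI:
  assumes "A \<in> W2 scale" "C \<in> W2 scale"
    and eq: "\<And>t l. t \<in> {1, 2} \<Longrightarrow> l \<in> {1, 2} \<Longrightarrow> A (v t) (v l) = C (v t) (v l)"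
  shows "A = C"
proof -
  interpret P: vector_space_pair scale scale by unfold_locales
  have basis_l: "A (v t) = C (v t)" if "t \<in> {1, 2}" for t
  proof
    fix y
    show "A (v t) y = C (v t) y"
      by (rule P.linear_eq_on[of "A (v t)" "C (v t)" y "v ` {1, 2}"])
        (use assms that span_v in \<open>auto simp: W2_def\<close>)
  qed
  show ?thesis
  proof (intro ext)
    fix x y
    show "A x y = C x y"
      by (rule P.linear_eq_on[of "\<lambda>x. A x y" "\<lambda>x. C x y" x "v ` {1, 2}"])
        (use assms basis_l span_v in \<open>auto simp: W2_def\<close>)
  qed
qed

lemma alpha_unique:
  assumes "i \<in> {1, 2}" "j \<in> {1, 2}" "m \<in> {1, 2}"
  shows "\<exists>!A. A \<in> W2 scale \<and>
    (\<forall>t\<in>{1, 2}. \<forall>l\<in>{1, 2}. A (v t) (v l) = (if i = t \<and> j = l then v m else 0))"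
proof -
  define r where "r = representation (v ` {1, 2})"
  define A where "A = (\<lambda>x y. scale (r x (v i) * r y (v j)) (v m))"
  have r_add: "r (x + y) b = r x b + r y b" for x y b
    unfolding r_def using representation_add[OF independent_v] span_v by simp
  have r_scale: "r (scale c x) b = c * r x b" for c x b
    unfolding r_def using representation_scale[OF independent_v] span_v by simp
  have r_basis: "r (v t) (v s) = (if s = t then 1 else 0)" if "t \<in> {1, 2}" "s \<in> {1, 2}" for t s
  proof -
    have "r (v t) = (\<lambda>b. if b = v t then 1 else 0)"
      unfolding r_def by (rule representation_basis[OF independent_v]) (use that in blast)
    then show ?thesis using inj_v that by (auto simp: inj_on_def)
  qed
  have "A \<in> W2 scale"
    unfolding W2_def A_def
    by (auto intro!: Vector_Spaces.linear.intro module_hom.intro module_hom_axioms.intro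
        vector_space_axioms module_axioms
        simp: r_add r_scale algebra_simps)
  moreover have "\<forall>t\<in>{1, 2}. \<forall>l\<in>{1, 2}. A (v t) (v l) = (if i = t \<and> j = l then v m else 0)"
    using assms by (auto simp: A_def r_basis)
  ultimately show ?thesis
    by (intro ex1I[of _ A]) (auto intro!: W2_eqI)
qed

lemma alpha_in_W2:
  "\<lbrakk>i \<in> {1, 2}; j \<in> {1, 2}; m \<in> {1, 2}\<rbrakk> \<Longrightarrow> alpha scale v i j m \<in> W2 scale"
  unfolding alpha_def using theI'[OF alpha_unique] by blast

lemma alpha_basis:
  "\<lbrakk>i \<in> {1, 2}; j \<in> {1, 2}; m \<in> {1, 2}; t \<in> {1, 2}; l \<in> {1, 2}\<rbrakk> \<Longrightarrow>
    alpha scale v i j m (v t) (v l) = (if i = t \<and> j = l then v m else 0)"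
  unfolding alpha_def using theI'[OF alpha_unique] by blast

lemma subspace_W2: "maps.subspace (W2 scale)"
  unfolding maps.subspace_def W2_def
  by (simp add: map_scale_def linear_iff scale_right_distrib scale_left_commute add_ac)

lemma W2_mult_closed: "A \<in> W2 scale \<Longrightarrow> C \<in> W2 scale \<Longrightarrow> W2_mult v A C \<in> W2 scale"
  by (simp add: W2_def W2_mult_def linear_iff scale_right_diff_distrib algebra_simps)

definition alphas :: "('v \<Rightarrow> 'v \<Rightarrow> 'v) set" where
  "alphas = (\<lambda>(i, j, m). alpha scale v i j m) ` ({1, 2} \<times> {1, 2} \<times> {1, 2})"

lemma v_coeffs_zero:
  assumes "scale a (v 1) + scale b (v 2) = 0"
  shows "a = 0 \<and> b = 0"
proof -
  have ne: "v 1 \<noteq> v 2" using inj_v by (auto simp: inj_on_def)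
  define u where "u = (\<lambda>x. if x = v 1 then a else b)"
  have "(\<Sum>x\<in>v ` {1, 2}. scale (u x) x) = 0"
    using assms ne by (simp add: u_def)
  then have "\<forall>x\<in>v ` {1, 2}. u x = 0"
    using independent_v dependent_finite[of "v ` {1, 2}"] by blast
  then show ?thesis using ne by (auto simp: u_def)
qed

lemma v_coeffs: "\<exists>a b. x = scale a (v 1) + scale b (v 2)"
proof -
  have "x \<in> span (v ` {1, 2})" using span_v by simp
  then show ?thesis
    by (force simp: span_insert span_singleton algebra_simps)
qed

lemma alphas_basis:
  "maps.independent alphas" "maps.span alphas = W2 scale" "card alphas = 8"
proof -
  let ?I = "{1, 2} \<times> {1, 2} \<times> {1, 2} :: (nat \<times> nat \<times> nat) set"
  let ?f = "\<lambda>(i, j, m). alpha scale v i j m"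
  have lincomb: "(\<Sum>p\<in>?I. map_scale scale (c p) (?f p)) (v t) (v l) =
      scale (c (t, l, 1)) (v 1) + scale (c (t, l, 2)) (v 2)"
    if "t \<in> {1, 2}" "l \<in> {1, 2}" for c t l
  proof -
    have I: "?I = {(1,1,1),(1,1,2),(1,2,1),(1,2,2),(2,1,1),(2,1,2),(2,2,1),(2,2,2)}" by auto
    show ?thesis unfolding I using that
      by (auto simp: map_scale_def alpha_basis[simplified])
  qed
  have nz: "c p = 0" if z: "(\<Sum>p\<in>?I. map_scale scale (c p) (?f p)) = 0" and p: "p \<in> ?I" for c p
  proof -
    obtain t l m where p': "p = (t, l, m)" "t \<in> {1, 2}" "l \<in> {1, 2}" "m \<in> {1, 2}"
      using p by auto
    have "scale (c (t, l, 1)) (v 1) + scale (c (t, l, 2)) (v 2) = 0"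
      unfolding lincomb[OF p'(2,3), of c, symmetric] z by (simp only: zero_fun_apply)
    then show ?thesis using v_coeffs_zero p'(1,4) by blast
  qed
  obtain I where I: "I = ?I" by blast
  have finI: "finite I" unfolding I by simp
  have alphas_I: "alphas = ?f ` I" unfolding alphas_def I ..
  note lincomb = lincomb[folded I] and nz = nz[folded I]
  have inj: "inj_on ?f I"
  proof (rule inj_onI, rule ccontr)
    fix p q assume pq: "p \<in> I" "q \<in> I" "?f p = ?f q" "p \<noteq> q"
    define c where "c = (\<lambda>r. if r = p then 1 else if r = q then - 1 else (0::'k))"
    have "(\<Sum>r\<in>I. map_scale scale (c r) (?f r)) =
        (\<Sum>r\<in>{p, q}. map_scale scale (c r) (?f r))"
      by (rule sum.mono_neutral_right) (use pq finI in \<open>auto simp: c_def\<close>)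
    also have "\<dots> = map_scale scale (c p) (?f p) + map_scale scale (c q) (?f q)"
      using pq(4) by simp
    also have "\<dots> = 0" unfolding pq(3) using pq(4) by (simp add: c_def)
    finally have "c p = 0" using nz pq(1) by blast
    then show False by (simp add: c_def)
  qed
  show "card alphas = 8"
    unfolding alphas_I card_image[OF inj] unfolding I by (simp add: card_cartesian_product)
  have fin: "finite alphas" unfolding alphas_I using finI by simp
  show "maps.independent alphas"
    unfolding maps.dependent_finite[OF fin]
  proof (clarify)
    fix u A assume u: "(\<Sum>A\<in>alphas. map_scale scale (u A) A) = 0" "A \<in> alphas" "u A \<noteq> 0"
    have "(\<Sum>p\<in>I. map_scale scale (u (?f p)) (?f p)) = 0"
      using u(1) unfolding alphas_I sum.reindex[OF inj] by (simp add: o_def)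
    from nz[OF this] u(2,3) show False unfolding alphas_I by blast
  qed
  have sub: "alphas \<subseteq> W2 scale"
    unfolding alphas_def using alpha_in_W2 by auto
  show "maps.span alphas = W2 scale"
  proof
    show "maps.span alphas \<subseteq> W2 scale"
      using maps.span_minimal[OF sub subspace_W2] .
    show "W2 scale \<subseteq> maps.span alphas"
    proof
      fix A assume A: "A \<in> W2 scale"
      obtain a b where ab: "\<And>x. x = scale (a x) (v 1) + scale (b x) (v 2)"
        using v_coeffs by metis
      define c where "c = (\<lambda>(t, l, m). if m = (1::nat) then a (A (v t) (v l)) else b (A (v t) (v l)))"
      let ?S = "\<Sum>p\<in>I. map_scale scale (c p) (?f p)"
      have in_span: "?S \<in> maps.span alphas"
        by (intro maps.span_sum maps.span_scale maps.span_base) (simp add: alphas_I)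
      have "A = ?S"
      proof (rule W2_eqI[OF A])
        show "?S \<in> W2 scale"
          using in_span maps.span_minimal[OF sub subspace_W2] by blast
        show "A (v t) (v l) = ?S (v t) (v l)" if "t \<in> {1, 2}" "l \<in> {1, 2}" for t l
          unfolding lincomb[OF that] using ab[of "A (v t) (v l)"] by (simp add: c_def)
      qed
      then show "A \<in> maps.span alphas" using in_span by simp
    qed
  qed
qed

lemma dim_W2: "maps.dim (W2 scale) = 8"
  using maps.dim_span_eq_card_independent[OF alphas_basis(1)] alphas_basis(2,3) by simp

end

end

theory Submission
  imports Defs
begin

text \<open>
  The product \<open>A \<cdot> C\<close> is the natural action of the endomorphism \<open>A(v\<^sub>1, -)\<close> of \<open>E\<^sub>2\<close> on the tensor \<open>C\<close>,
  so \<open>W(2)\<close> is the \<open>gl\<^sub>2\<close>-module of bilinear maps together with the surjection \<open>A \<mapsto> A(v\<^sub>1, -)\<close>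
  onto \<open>gl\<^sub>2\<close>. Let \<open>K\<close> be the kernel of this surjection, that is, the set of left annihilators
  of \<open>W(2)\<close>, and let \<open>B\<close> be a subalgebra of codimension one.

  Suppose \<open>K\<close> is not contained in \<open>B\<close>. Then \<open>W(2) = B + K\<close>, and since \<open>K\<close> annihilates everything
  from the left, \<open>B\<close> is a submodule for the whole of \<open>gl\<^sub>2\<close>. The quotient \<open>W(2)/B\<close> is a
  line, on which commutators act as zero; in particular \<open>H = [E\<^sub>1\<^sub>2, E\<^sub>2\<^sub>1]\<close> maps \<open>W(2)\<close> into \<open>B\<close>. But
  \<open>H\<close> is diagonal on the basis \<open>\<alpha>\<^sub>i\<^sub>j\<^sup>m\<close> with weights \<open>\<plusminus>1\<close> and \<open>\<plusminus>3\<close> (\<open>weight_commutator\<close>), so it is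
  invertible when the characteristic is not three and \<open>B\<close> would be everything. Hence \<open>K \<subseteq> B\<close>
  (\<open>left_annihilator_subset\<close>).

  Suppose next that some \<open>A\<close> in \<open>B\<close> does not map \<open>(v\<^sub>1, v\<^sub>1)\<close> to a multiple of \<open>v\<^sub>1\<close>, say with
  coefficient \<open>c \<noteq> 0\<close> at \<open>v\<^sub>2\<close>. Then \<open>A \<cdot> \<alpha>\<^sub>2\<^sub>j\<^sup>m\<close> is \<open>- c \<alpha>\<^sub>1\<^sub>j\<^sup>m\<close> modulo \<open>K\<close>. As \<open>\<alpha>\<^sub>2\<^sub>j\<^sup>m\<close> lies in \<open>K \<subseteq> B\<close>,
  all basis elements lie in \<open>B\<close>, which is absurd
  (\<open>subalgebra_subset_line_stabilizer\<close>). So \<open>B\<close> is contained in the space of all \<open>A\<close> with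
  \<open>A(v\<^sub>1, v\<^sub>1)\<close> in the line of \<open>v\<^sub>1\<close>. This space is the asserted span and a proper subspace of \<open>W(2)\<close>, so
  it equals \<open>B\<close> because \<open>B\<close> has codimension one.
\<close>

section \<open>Bilinearity and codimension one\<close>

context two_dim_space
begin

lemma W2_add_left: "A \<in> W2 scale \<Longrightarrow> A (x + x') y = A x y + A x' y"
  and W2_add_right: "A \<in> W2 scale \<Longrightarrow> A x (y + y') = A x y + A x y'"
  and W2_scale_left: "A \<in> W2 scale \<Longrightarrow> A (scale c x) y = scale c (A x y)"
  and W2_scale_right: "A \<in> W2 scale \<Longrightarrow> A x (scale c y) = scale c (A x y)"
  by (simp_all add: W2_def linear_iff)

lemma W2_zero_left: "A \<in> W2 scale \<Longrightarrow> A 0 y = 0"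
  and W2_zero_right: "A \<in> W2 scale \<Longrightarrow> A x 0 = 0"
  using W2_scale_left[of A 0 0 y] W2_scale_right[of A x 0 0] by simp_all

lemma W2_minus_left: "A \<in> W2 scale \<Longrightarrow> A (- x) y = - A x y"
  and W2_minus_right: "A \<in> W2 scale \<Longrightarrow> A x (- y) = - A x y"
  using W2_scale_left[of A "-1" x y] W2_scale_right[of A x "-1" y] by simp_all

lemma W2_diff_left: "A \<in> W2 scale \<Longrightarrow> A (x - x') y = A x y - A x' y"
  and W2_diff_right: "A \<in> W2 scale \<Longrightarrow> A x (y - y') = A x y - A x y'"
  using W2_add_left[of A x "- x'" y] W2_add_right[of A x y "- y'"]
  by (simp_all add: W2_minus_left W2_minus_right)

lemmas W2_bilinear = W2_add_left W2_add_right W2_scale_left W2_scale_right W2_zero_left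
  W2_zero_right W2_minus_left W2_minus_right W2_diff_left W2_diff_right

lemma W2_mult_bilinear:
  assumes "A \<in> W2 scale" "C \<in> W2 scale"
  shows "W2_mult v (A - map_scale scale c A') C = W2_mult v A C - map_scale scale c (W2_mult v A' C)"
    and "W2_mult v A (C - map_scale scale c C') = W2_mult v A C - map_scale scale c (W2_mult v A C')"
  using assms
  by (auto simp: W2_mult_def fun_eq_iff map_scale_def W2_bilinear scale_right_diff_distrib algebra_simps)

text \<open>The space of all maps \<open>E\<^sub>2 \<times> E\<^sub>2 \<rightarrow> E\<^sub>2\<close> is infinite-dimensional when the field is infinite, so the
  dimension count is carried out inside \<open>W(2)\<close>: adjoining two independent vectors to a basis
  of \<open>B\<close> would give nine independent elements in the span of the eight \<open>\<alpha>\<^sub>i\<^sub>j\<^sup>m\<close>.\<close>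

lemma codim_one_complement:
  assumes "maps.subspace B" "B \<subseteq> W2 scale" "maps.dim (W2 scale) = maps.dim B + 1"
    and e: "e \<in> W2 scale" "e \<notin> B" and A: "A \<in> W2 scale"
  shows "\<exists>c. A - map_scale scale c e \<in> B"
proof -
  obtain S where S: "S \<subseteq> B" "maps.independent S" "B \<subseteq> maps.span S" "card S = maps.dim B"
    using maps.basis_exists by blast
  have span_S: "maps.span S = B"
    using S assms(1) maps.span_minimal by blast
  have fin: "finite alphas"
    using alphas_basis(3) card.infinite by fastforce
  have bound: "finite T \<and> card T \<le> 8" if "maps.independent T" "T \<subseteq> W2 scale" for T
    using maps.independent_span_bound[OF fin that(1)] that(2) alphas_basis(2,3) by simp
  have finS: "finite S" using bound S assms(2) by blast
  have indep_e: "maps.independent (insert e S)"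
    using S(2) e(2) span_S maps.independent_insertI by blast
  have "A \<in> maps.span (insert e S)"
  proof (rule ccontr)
    assume notin: "A \<notin> maps.span (insert e S)"
    have "card (insert A (insert e S)) \<le> 8"
      using bound[OF maps.independent_insertI[OF notin indep_e]] A e(1) S(1) assms(2) by blast
    moreover have "A \<notin> insert e S" "e \<notin> S"
      using notin maps.span_base S(1) e(2) by blast+
    ultimately show False
      using finS S(4) assms(3) dim_W2 by simp
  qed
  then show ?thesis
    by (simp add: maps.span_breakdown_eq span_S)
qed

lemma alphas_not_subset:
  assumes "maps.subspace B" "B \<subseteq> W2 scale" "maps.dim (W2 scale) = maps.dim B + 1"
  shows "\<not> alphas \<subseteq> B"
proof
  assume "alphas \<subseteq> B"
  then have "W2 scale \<subseteq> B"
    using maps.span_minimal[of alphas B] assms(1) alphas_basis(2) by simp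
  with assms show False by simp
qed

section \<open>Left annihilators belong to the subalgebra\<close>

text \<open>\<open>\<alpha>\<^sub>1\<^sub>2\<^sup>1\<close> and \<open>\<alpha>\<^sub>1\<^sub>1\<^sup>2\<close> act as the matrix units \<open>E\<^sub>1\<^sub>2\<close> and \<open>E\<^sub>2\<^sub>1\<close>, so the left-hand side is the action
  of \<open>H = diag(1, -1)\<close>. A tensor with two arguments and one value in the standard representation has
  odd weight, which is why \<open>0\<close> does not occur.\<close>

lemma weight_commutator:
  assumes "i \<in> {1, 2}" "j \<in> {1, 2}" "m \<in> {1, 2}"
  shows "\<exists>w\<in>{1, -1, 3, -3}.
    W2_mult v (alpha scale v 1 2 1) (W2_mult v (alpha scale v 1 1 2) (alpha scale v i j m)) -
    W2_mult v (alpha scale v 1 1 2) (W2_mult v (alpha scale v 1 2 1) (alpha scale v i j m)) =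
    map_scale scale w (alpha scale v i j m)"
proof -
  define h where "h n = (if n = 1 then 1 else - 1 :: 'k)" for n :: nat
  let ?w = "h m - h i - h j"
  let ?X = "alpha scale v 1 2 1" and ?Y = "alpha scale v 1 1 2" and ?A = "alpha scale v i j m"
  let ?C = "W2_mult v ?X (W2_mult v ?Y ?A) - W2_mult v ?Y (W2_mult v ?X ?A)"
  have in_W2: "?X \<in> W2 scale" "?Y \<in> W2 scale" "?A \<in> W2 scale"
    using assms by (auto intro: alpha_in_W2)
  \<comment> \<open>A value \<open>v\<^sub>m\<close> contributes its weight \<open>h m\<close>, the two arguments the negatives of theirs.\<close>
  have "?C = map_scale scale ?w ?A"
  proof (rule W2_eqI)
    show "?C \<in> W2 scale"
      by (intro maps.subspace_diff[OF subspace_W2] W2_mult_closed in_W2)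
    show "map_scale scale ?w ?A \<in> W2 scale"
      by (intro maps.subspace_scale[OF subspace_W2] in_W2)
    have triple: "scale 3 x = x + x + x" for x
      using scale_left_distrib[of 2 1 x] scale_left_distrib[of 1 1 x] by simp
    show "?C (v t) (v l) = map_scale scale ?w ?A (v t) (v l)"
      if "t \<in> {1, 2}" "l \<in> {1, 2}" for t l
      using assms that
      by (auto simp: W2_mult_def map_scale_def W2_bilinear alpha_in_W2 alpha_basis h_def triple
          simp del: One_nat_def)
  qed
  moreover have "?w \<in> {1, -1, 3, -3}" using assms by (auto simp: h_def)
  ultimately show ?thesis by blast
qed

text \<open>If a left annihilator \<open>A\<close> lies outside \<open>B\<close>, then every element of \<open>W(2)\<close> acts like its component
  in \<open>B\<close>. So \<open>B\<close> is a left ideal, and left multiplications induce scalars on the line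
  \<open>W(2)/B\<close>; these commute, so \<open>B\<close> contains every image of \<open>H\<close>.\<close>

lemma left_annihilator_subset:
  assumes three: "(3::'k) \<noteq> 0"
    and B: "W2_subalgebra scale v B"
    and codim: "maps.dim (W2 scale) = maps.dim B + 1"
    and A: "A \<in> W2 scale" "A (v 1) = 0"
  shows "A \<in> B"
proof (rule ccontr)
  assume notin: "A \<notin> B"
  have sub: "B \<subseteq> W2 scale" and subsp: "maps.subspace B"
    and mult: "\<And>X C. X \<in> B \<Longrightarrow> C \<in> B \<Longrightarrow> W2_mult v X C \<in> B"
    using B by (auto simp: W2_subalgebra_def)
  note complement = codim_one_complement[OF subsp sub codim A(1) notin]
  have A_mult: "W2_mult v A C = 0" if "C \<in> W2 scale" for C
    using that A(2) by (simp add: W2_mult_def fun_eq_iff W2_bilinear)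
  have ideal: "W2_mult v X C \<in> B" if X: "X \<in> W2 scale" and C: "C \<in> B" for X C
  proof -
    obtain c where "X - map_scale scale c A \<in> B" using complement[OF X] by blast
    then have "W2_mult v (X - map_scale scale c A) C \<in> B" using mult C by blast
    then show ?thesis
      using W2_mult_bilinear(1)[of X C c A] X C sub A_mult by (simp add: subset_iff)
  qed
  have commutator: "W2_mult v X (W2_mult v Y C) - W2_mult v Y (W2_mult v X C) \<in> B"
    if XY: "X \<in> W2 scale" "Y \<in> W2 scale" and C: "C \<in> W2 scale" for X Y C
  proof -
    \<comment> \<open>The scalar is read off from the generator \<open>A\<close> of \<open>W(2)\<close> modulo \<open>B\<close>.\<close>
    have scalar: "\<exists>l. \<forall>C\<in>W2 scale. W2_mult v X C - map_scale scale l C \<in> B" if X: "X \<in> W2 scale" for X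
    proof -
      obtain l where l: "W2_mult v X A - map_scale scale l A \<in> B"
        using complement[OF W2_mult_closed[OF X A(1)]] by blast
      have "W2_mult v X C - map_scale scale l C \<in> B" if C: "C \<in> W2 scale" for C
      proof -
        obtain c where c: "C - map_scale scale c A \<in> B" using complement[OF C] by blast
        have "W2_mult v X C - map_scale scale l C =
            W2_mult v X (C - map_scale scale c A) +
            map_scale scale c (W2_mult v X A - map_scale scale l A) -
            map_scale scale l (C - map_scale scale c A)"
          unfolding W2_mult_bilinear(2)[OF X C]
          by (simp add: maps.scale_right_diff_distrib maps.scale_left_commute)
        then show ?thesis
          using ideal[OF X c] c l
          by (simp add: subsp maps.subspace_add maps.subspace_diff maps.subspace_scale)
      qed
      then show ?thesis by blast
    qed
    obtain l where l: "\<And>C. C \<in> W2 scale \<Longrightarrow> W2_mult v X C - map_scale scale l C \<in> B"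
      using scalar[OF XY(1)] by blast
    obtain k where k: "\<And>C. C \<in> W2 scale \<Longrightarrow> W2_mult v Y C - map_scale scale k C \<in> B"
      using scalar[OF XY(2)] by blast
    have XYC: "W2_mult v X (W2_mult v Y C) - map_scale scale l (W2_mult v Y C) \<in> B"
      by (intro l W2_mult_closed XY C)
    have YXC: "W2_mult v Y (W2_mult v X C) - map_scale scale k (W2_mult v X C) \<in> B"
      by (intro k W2_mult_closed XY C)
    \<comment> \<open>Modulo \<open>B\<close> both products are congruent to \<open>l k C\<close>.\<close>
    have "W2_mult v X (W2_mult v Y C) - map_scale scale (l * k) C \<in> B"
      using maps.subspace_add[OF subsp XYC maps.subspace_scale[OF subsp k[OF C], of l]]
      by (simp add: maps.scale_right_diff_distrib)
    moreover have "W2_mult v Y (W2_mult v X C) - map_scale scale (l * k) C \<in> B"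
      using maps.subspace_add[OF subsp YXC maps.subspace_scale[OF subsp l[OF C], of k]]
      by (simp add: maps.scale_right_diff_distrib mult.commute)
    ultimately show ?thesis
      using maps.subspace_diff[OF subsp] by fastforce
  qed
  have "alphas \<subseteq> B"
  proof (clarsimp simp only: alphas_def subset_iff image_iff Bex_def mem_Sigma_iff)
    fix i j m :: nat
    assume ijm: "i \<in> {1, 2}" "j \<in> {1, 2}" "m \<in> {1, 2}"
    obtain w where w: "w \<in> {1, -1, 3, -3}"
      and "W2_mult v (alpha scale v 1 2 1) (W2_mult v (alpha scale v 1 1 2) (alpha scale v i j m)) -
        W2_mult v (alpha scale v 1 1 2) (W2_mult v (alpha scale v 1 2 1) (alpha scale v i j m)) =
        map_scale scale w (alpha scale v i j m)"
      using weight_commutator[OF ijm] by blast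
    then have "map_scale scale w (alpha scale v i j m) \<in> B"
      using commutator[of "alpha scale v 1 2 1" "alpha scale v 1 1 2" "alpha scale v i j m"]
        alpha_in_W2 ijm by simp
    then have "map_scale scale (inverse w) (map_scale scale w (alpha scale v i j m)) \<in> B"
      using subsp maps.subspace_scale by blast
    moreover have "w \<noteq> 0" using w three by auto
    ultimately show "alpha scale v i j m \<in> B" by simp
  qed
  then show False using alphas_not_subset[OF subsp sub codim] by blast
qed

section \<open>Maps that preserve the first coordinate line\<close>

definition line_stabilizer :: "('v \<Rightarrow> 'v \<Rightarrow> 'v) set" where
  "line_stabilizer = {A \<in> W2 scale. \<exists>c. A (v 1) (v 1) = scale c (v 1)}"

lemma subspace_line_stabilizer: "maps.subspace line_stabilizer"
  unfolding maps.subspace_def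
proof (intro conjI ballI allI)
  show "0 \<in> line_stabilizer"
    using maps.subspace_0[OF subspace_W2] by (auto simp: line_stabilizer_def intro!: exI[of _ 0])
next
  fix A C assume "A \<in> line_stabilizer" "C \<in> line_stabilizer"
  then show "A + C \<in> line_stabilizer"
    using maps.subspace_add[OF subspace_W2]
    by (auto simp: line_stabilizer_def scale_left_distrib[symmetric])
next
  fix c A assume "A \<in> line_stabilizer"
  then show "map_scale scale c A \<in> line_stabilizer"
    using maps.subspace_scale[OF subspace_W2]
    by (auto simp: line_stabilizer_def map_scale_def)
qed

text \<open>Membership says exactly that the coefficient at \<open>\<alpha>\<^sub>1\<^sub>1\<^sup>2\<close>, the only basis element absent
  from the span, is zero.\<close>

lemma line_stabilizer_eq_span:
  "line_stabilizer = maps.span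
    {alpha scale v 1 1 1, alpha scale v 1 2 1, alpha scale v 2 1 1, alpha scale v 2 2 1,
     alpha scale v 1 2 2, alpha scale v 2 1 2, alpha scale v 2 2 2}" (is "_ = maps.span ?S")
proof
  have "?S \<subseteq> line_stabilizer"
    using alpha_in_W2 
    by (auto simp: line_stabilizer_def alpha_basis simp del: One_nat_def intro: exI[of _ 0] exI[of _ 1])
  then show span_sub: "maps.span ?S \<subseteq> line_stabilizer"
    by (rule maps.span_minimal[OF _ subspace_line_stabilizer])
  show "line_stabilizer \<subseteq> maps.span ?S"
  proof
    fix A assume A: "A \<in> line_stabilizer"
    have "alphas = insert (alpha scale v 1 1 2) ?S"
      by (auto simp: alphas_def simp del: One_nat_def)
    then obtain k where k: "A - map_scale scale k (alpha scale v 1 1 2) \<in> maps.span ?S"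
      using A alphas_basis(2) maps.span_breakdown_eq[of A "alpha scale v 1 1 2" ?S]
      by (auto simp: line_stabilizer_def)
    have "A - (A - map_scale scale k (alpha scale v 1 1 2)) \<in> line_stabilizer"
      using maps.subspace_diff[OF subspace_line_stabilizer A] k span_sub by blast
    then obtain c where "scale k (v 2) = scale c (v 1)"
      by (auto simp: line_stabilizer_def map_scale_def alpha_basis simp del: One_nat_def)
    then have "scale c (v 1) + scale (- k) (v 2) = 0" by simp
    then have "k = 0" using v_coeffs_zero by fastforce
    with k show "A \<in> maps.span ?S" by simp
  qed
qed

text \<open>An element \<open>A\<close> of \<open>B\<close> with \<open>A(v\<^sub>1, v\<^sub>1) = p v\<^sub>1 + c v\<^sub>2\<close> and \<open>c \<noteq> 0\<close> turns the annihilators \<open>\<alpha>\<^sub>2\<^sub>j\<^sup>m\<close>, which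
  see only the \<open>v\<^sub>2\<close>-component of their first argument, into nonzero multiples of \<open>\<alpha>\<^sub>1\<^sub>j\<^sup>m\<close>
  modulo annihilators; then \<open>B\<close> is all of \<open>W(2)\<close>.\<close>

lemma subalgebra_subset_line_stabilizer:
  assumes B: "W2_subalgebra scale v B"
    and codim: "maps.dim (W2 scale) = maps.dim B + 1"
    and ann: "\<And>A. A \<in> W2 scale \<Longrightarrow> A (v 1) = 0 \<Longrightarrow> A \<in> B"
  shows "B \<subseteq> line_stabilizer"
proof (rule ccontr)
  have sub: "B \<subseteq> W2 scale" and subsp: "maps.subspace B"
    and mult: "\<And>X C. X \<in> B \<Longrightarrow> C \<in> B \<Longrightarrow> W2_mult v X C \<in> B"
    using B by (auto simp: W2_subalgebra_def)
  have annI: "A \<in> B"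
    if A: "A \<in> W2 scale" and vals: "\<And>l. l \<in> {1, 2} \<Longrightarrow> A (v 1) (v l) = 0" for A
  proof (rule ann[OF A], rule ext)
    fix x
    obtain a b where "x = scale a (v 1) + scale b (v 2)" using v_coeffs by blast
    then show "A (v 1) x = 0 x" using vals by (simp add: A W2_bilinear)
  qed
  assume "\<not> B \<subseteq> line_stabilizer"
  then obtain A where A: "A \<in> B" "A \<notin> line_stabilizer" by blast
  then have A_W2: "A \<in> W2 scale" using sub by blast
  obtain p c where pc: "A (v 1) (v 1) = scale p (v 1) + scale c (v 2)" using v_coeffs by blast
  have c: "c \<noteq> 0"
  proof
    assume "c = 0"
    then show False using A A_W2 pc by (simp add: line_stabilizer_def)
  qed
  have second: "alpha scale v 2 j m \<in> B" if "j \<in> {1, 2}" "m \<in> {1, 2}" for j m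
    by (rule annI) (use that alpha_in_W2 alpha_basis in auto)
  have first: "alpha scale v 1 j m \<in> B" if jm: "j \<in> {1, 2}" "m \<in> {1, 2}" for j m
  proof -
    let ?C = "alpha scale v 2 j m" and ?D = "alpha scale v 1 j m"
    have W: "?C \<in> W2 scale" "?D \<in> W2 scale" using jm by (auto intro: alpha_in_W2)
    have C_first: "?C (v 1) x = 0" for x
    proof -
      obtain a b where "x = scale a (v 1) + scale b (v 2)" using v_coeffs by blast
      then show ?thesis using jm W by (simp add: W2_bilinear alpha_basis del: One_nat_def)
    qed
    have "W2_mult v A ?C + map_scale scale c ?D \<in> B"
    proof (rule annI)
      show "W2_mult v A ?C + map_scale scale c ?D \<in> W2 scale"
        by (intro maps.subspace_add[OF subspace_W2] maps.subspace_scale[OF subspace_W2]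
            W2_mult_closed A_W2 W)
      show "(W2_mult v A ?C + map_scale scale c ?D) (v 1) (v l) = 0" if "l \<in> {1, 2}" for l
        using that jm
        by (auto simp: W2_mult_def map_scale_def C_first pc W A_W2 W2_bilinear alpha_basis
            simp del: One_nat_def)
    qed
    from maps.subspace_diff[OF subsp this mult[OF A(1) second[OF jm]]]
    have "map_scale scale c ?D \<in> B" by simp
    then have "map_scale scale (inverse c) (map_scale scale c ?D) \<in> B"
      using subsp maps.subspace_scale by blast
    then show ?thesis using c by simp
  qed
  have "alphas \<subseteq> B" using first second by (auto simp: alphas_def simp del: One_nat_def)
  then show False using alphas_not_subset[OF subsp sub codim] by blast
qed

text \<open>A subspace of codimension one that is contained in a proper subspace equals it; here
  \<open>\<alpha>\<^sub>1\<^sub>1\<^sup>2\<close> witnesses that \<open>line_stabilizer\<close> is proper.\<close>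

lemma codim_one_subalgebra_eq_line_stabilizer:
  assumes three: "(3::'k) \<noteq> 0"
    and B: "W2_subalgebra scale v B"
    and codim: "maps.dim (W2 scale) = maps.dim B + 1"
  shows "B = line_stabilizer"
proof
  have sub: "B \<subseteq> W2 scale" and subsp: "maps.subspace B"
    using B by (auto simp: W2_subalgebra_def)
  show B_sub: "B \<subseteq> line_stabilizer"
    using subalgebra_subset_line_stabilizer[OF B codim] left_annihilator_subset[OF three B codim]
    by blast
  show "line_stabilizer \<subseteq> B"
  proof (rule ccontr)
    assume "\<not> line_stabilizer \<subseteq> B"
    then obtain e where e: "e \<in> line_stabilizer" "e \<notin> B" by blast
    let ?A = "alpha scale v 1 1 2"
    have "?A \<in> W2 scale" "e \<in> W2 scale"
      using e(1) by (auto simp: line_stabilizer_def intro: alpha_in_W2)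
    then obtain c where "?A - map_scale scale c e \<in> B"
      using codim_one_complement[OF subsp sub codim _ e(2)] by blast
    then have "?A - map_scale scale c e + map_scale scale c e \<in> line_stabilizer"
      using B_sub e(1) subspace_line_stabilizer
      by (blast intro: maps.subspace_add maps.subspace_scale)
    then obtain d where "v 2 = scale d (v 1)"
      by (auto simp: line_stabilizer_def alpha_basis simp del: One_nat_def)
    then have "scale d (v 1) + scale (- 1) (v 2) = 0" by simp
    then show False using v_coeffs_zero by fastforce
  qed
qed

end

theorem theorem4:
  fixes scale :: "'k::field_char_0 \<Rightarrow> 'v::ab_group_add \<Rightarrow> 'v"
    and v :: "nat \<Rightarrow> 'v"
    and B :: "('v \<Rightarrow> 'v \<Rightarrow> 'v) set"
  assumes "two_dim_space scale v"
    and "W2_subalgebra scale v B"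
    and "vector_space.dim (map_scale scale) (W2 scale) =
           vector_space.dim (map_scale scale) B + 1"
  shows "B = module.span (map_scale scale)
    {alpha scale v 1 1 1, alpha scale v 1 2 1, alpha scale v 2 1 1, alpha scale v 2 2 1,
     alpha scale v 1 2 2, alpha scale v 2 1 2, alpha scale v 2 2 2}"
proof -
  interpret two_dim_space scale v by fact
  have "B = line_stabilizer"
    using assms by (intro codim_one_subalgebra_eq_line_stabilizer) auto
  then show ?thesis using line_stabilizer_eq_span by simp
qed

end
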